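(* For every $m\ge 3$, $\gamma(R(3,m))=6$.
   Context: The ground field is $\mathbb{C}$. $\operatorname{Mat}_{n,n}$ is the space of $n\times n$ complex matrices. The group $\operatorname{SL}_n\times\operatorname{SL}_n$ acts on $\operatorname{Mat}_{n,n}^m$ by $(A,B)\circ(X_1,\dots,X_m)=(AX_1B^{-1},\dots,AX_mB^{-1})$, and $R(n,m)=\mathbb{C}[\operatorname{Mat}_{n,n}^m]^{\operatorname{SL}_n\times\operatorname{SL}_n}$ is the ring of invariant polynomials, graded by the usual degree of polynomials in the matrix entries. The null cone of $R(n,m)$ is the set of $v\in\operatorname{Mat}_{n,n}^m$ such that $f(v)=0$ for every homogeneous $f\in R(n,m)$ of positive degree. $\gamma(R(n,m))$ is the smallest integer $D$ such that the null cone is the common zero set of the homogeneous invariants of positive degree $\le D$. *)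

theory Defs
  imports "HOL-Analysis.Analysis" "HOL-Library.Poly_Mapping"
begin

text \<open>
  An \<open>m\<close>-tuple of complex \<open>n\<close> by \<open>n\<close> matrices is an element \<open>X\<close> of \<open>complex^'n^'n^'m\<close> with
  \<open>n = CARD('n)\<close> and \<open>m = CARD('m)\<close>; \<open>X $ k $ i $ j\<close> is the entry \<open>(i, j)\<close> of the
  \<open>k\<close>-th matrix. The coordinate ring of this space is the polynomial ring in the variables
  indexed by triples \<open>(k, i, j)\<close>. A monomial is a finitely supported exponent map and a
  polynomial is a finitely supported map from monomials to coefficients; \<open>Poly_Mapping\<close>
  equips this type with its (convolution) ring structure.
\<close>

type_synonym ('n, 'm) mat_poly = "(('m \<times> 'n \<times> 'n) \<Rightarrow>\<^sub>0 nat) \<Rightarrow>\<^sub>0 complex"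

definition mat_poly_eval ::
    "('n::finite, 'm::finite) mat_poly \<Rightarrow> complex^'n^'n^'m \<Rightarrow> complex" where
  "mat_poly_eval f X =
     (\<Sum>t\<in>Poly_Mapping.keys f. Poly_Mapping.lookup f t *
        (\<Prod>(k, i, j)\<in>UNIV. (X $ k $ i $ j) ^ Poly_Mapping.lookup t (k, i, j)))"

definition homogeneous_of_degree ::
    "nat \<Rightarrow> ('n::finite, 'm::finite) mat_poly \<Rightarrow> bool" where
  "homogeneous_of_degree d f \<longleftrightarrow>
     (\<forall>t\<in>Poly_Mapping.keys f. (\<Sum>v\<in>UNIV. Poly_Mapping.lookup t v) = d)"

definition SL :: "(complex^'n^'n) set" where
  "SL = {A. det A = 1}"

definition left_right_action ::
    "complex^'n^'n \<Rightarrow> complex^'n^'n \<Rightarrow> complex^'n^'n^'m \<Rightarrow> complex^'n^'n^'m" where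
  "left_right_action A B X = (\<chi> k. A ** (X $ k) ** matrix_inv B)"

text \<open>
  The ring of invariants \<open>R(n, m)\<close>. As the ground field is infinite, a polynomial is invariant
  if and only if the function it induces is.
\<close>

definition matrix_semi_invariants :: "('n::finite, 'm::finite) mat_poly set" where
  "matrix_semi_invariants =
     {f. \<forall>A\<in>SL. \<forall>B\<in>SL. \<forall>X. mat_poly_eval f (left_right_action A B X) = mat_poly_eval f X}"

definition null_cone ::
    "('n::finite, 'm::finite) mat_poly set \<Rightarrow> (complex^'n^'n^'m) set" where
  "null_cone R =
     {X. \<forall>f\<in>R. \<forall>d>0. homogeneous_of_degree d f \<longrightarrow> mat_poly_eval f X = 0}"

definition zero_set_upto ::
    "nat \<Rightarrow> ('n::finite, 'm::finite) mat_poly set \<Rightarrow> (complex^'n^'n^'m) set" where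
  "zero_set_upto D R =
     {X. \<forall>f\<in>R. \<forall>d. 0 < d \<and> d \<le> D \<and> homogeneous_of_degree d f \<longrightarrow> mat_poly_eval f X = 0}"

definition null_cone_gamma :: "('n::finite, 'm::finite) mat_poly set \<Rightarrow> nat" where
  "null_cone_gamma R = (LEAST D. null_cone R = zero_set_upto D R)"

end

theory Submission
  imports Defs
begin

text \<open>
  If all invariants of degree at most 6 vanish at \<open>X\<close>, then the span \<open>V\<close> of the matrices of \<open>X\<close>
  consists of singular matrices (degree 3), and \<open>tr (A adj(B) C adj(D)) = 0\<close> on \<open>V\<close> (degree 6).
  If \<open>V\<close> contains a matrix of rank 2, say \<open>diag(1,1,0)\<close>, then every \<open>Y\<close> in \<open>V\<close> has entry
  \<open>0\<close> at position \<open>(3, 3)\<close>, its border column \<open>b\<close> and border row \<open>c\<close> satisfy \<open>c b = 0\<close>, and the degree 6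
  condition forces all border columns or all border rows to be parallel. This yields a zero row, a
  zero column or a \<open>2\<times>2\<close> block of zeros in suitable bases, hence a one-parameter subgroup that
  contracts \<open>X\<close> to 0, so \<open>X\<close> lies in the null cone. The case of rank at most 1 is similar.

  For the lower bound, take a basis of the skew-symmetric matrices: a degree 6 invariant is nonzero
  there. Scalar matrices of determinant 1 kill the invariants whose degree is not divisible by 3. For
  a cubic invariant, the diagonal torus reduces its value to a difference of its values at two
  tuples of matrix units, which lie in one orbit.
\<close>

subsection \<open>Homogeneous polynomial functions\<close>

definition mon :: "(('m::finite \<times> 'n::finite \<times> 'n) \<Rightarrow>\<^sub>0 nat) \<Rightarrow> complex^'n^'n^'m \<Rightarrow> complex" where
  "mon t X = (\<Prod>(k, i, j)\<in>UNIV. (X $ k $ i $ j) ^ Poly_Mapping.lookup t (k, i, j))"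

lemma mon_add: "mon (s + t) X = mon s X * mon t X"
  by (simp add: mon_def lookup_add power_add prod.distrib case_prod_unfold)

lemma mat_poly_eval_superset:
  assumes "finite S" "Poly_Mapping.keys f \<subseteq> S"
  shows "mat_poly_eval f X = (\<Sum>t\<in>S. Poly_Mapping.lookup f t * mon t X)"
  unfolding mat_poly_eval_def mon_def[symmetric]
  by (rule sum.mono_neutral_left) (use assms in \<open>auto simp: in_keys_iff\<close>)

lemma mat_poly_eval_keys:
  "mat_poly_eval f X = (\<Sum>t\<in>Poly_Mapping.keys f. Poly_Mapping.lookup f t * mon t X)"
  by (rule mat_poly_eval_superset) auto

lemma mat_poly_eval_add: "mat_poly_eval (f + g) X = mat_poly_eval f X + mat_poly_eval g X"
proof -
  let ?S = "Poly_Mapping.keys f \<union> Poly_Mapping.keys g"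
  have "mat_poly_eval h X = (\<Sum>t\<in>?S. Poly_Mapping.lookup h t * mon t X)"
    if "Poly_Mapping.keys h \<subseteq> ?S" for h
    using that by (intro mat_poly_eval_superset) auto
  then show ?thesis
    by (simp add: Poly_Mapping.keys_add lookup_add distrib_right sum.distrib)
qed

lemma mat_poly_eval_single: "mat_poly_eval (Poly_Mapping.single t c) X = c * mon t X"
  by (subst mat_poly_eval_superset[where S = "{t}"]) auto

text \<open>Homogeneity is attached to functions, so that determinants and traces can be treated by
  closed formulas; a formal polynomial is chosen only at the end, in
  \<open>hom_poly_fun_semi_invariant\<close>.\<close>

definition hom_poly_fun :: "nat \<Rightarrow> (complex^'n^'n^'m \<Rightarrow> complex) \<Rightarrow> bool" where
  "hom_poly_fun d F \<longleftrightarrow>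
     (\<exists>f :: ('n::finite, 'm::finite) mat_poly. homogeneous_of_degree d f \<and> mat_poly_eval f = F)"

lemma hom_poly_fun_zero: "hom_poly_fun d (\<lambda>X. 0)"
  unfolding hom_poly_fun_def
  by (rule exI[of _ 0]) (auto simp: homogeneous_of_degree_def mat_poly_eval_def)

lemma hom_poly_fun_add:
  assumes "hom_poly_fun d F" "hom_poly_fun d G"
  shows "hom_poly_fun d (\<lambda>X. F X + G X)"
proof -
  obtain f g where "homogeneous_of_degree d f" "mat_poly_eval f = F"
    "homogeneous_of_degree d g" "mat_poly_eval g = G"
    using assms unfolding hom_poly_fun_def by blast
  moreover from this have "homogeneous_of_degree d (f + g)"
    using Poly_Mapping.keys_add[of f g] unfolding homogeneous_of_degree_def by blast
  ultimately show ?thesis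
    unfolding hom_poly_fun_def by (intro exI[of _ "f + g"]) (auto simp: mat_poly_eval_add)
qed

lemma hom_poly_fun_sum:
  assumes "\<And>x. x \<in> S \<Longrightarrow> hom_poly_fun d (F x)"
  shows "hom_poly_fun d (\<lambda>X. \<Sum>x\<in>S. F x X)"
  using assms
  by (induction S rule: infinite_finite_induct) (auto intro: hom_poly_fun_zero hom_poly_fun_add)

lemma hom_poly_fun_single:
  assumes "(\<Sum>v\<in>UNIV. Poly_Mapping.lookup t v) = d"
  shows "hom_poly_fun d (\<lambda>X. c * mon t X)"
  unfolding hom_poly_fun_def
  by (rule exI[of _ "Poly_Mapping.single t c"])
     (use assms in \<open>auto simp: homogeneous_of_degree_def mat_poly_eval_single fun_eq_iff\<close>)

lemma hom_poly_fun_mult: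
  assumes "hom_poly_fun d F" "hom_poly_fun e G"
  shows "hom_poly_fun (d + e) (\<lambda>X. F X * G X)"
proof -
  obtain f g where f: "homogeneous_of_degree d f" "F = mat_poly_eval f"
    and g: "homogeneous_of_degree e g" "G = mat_poly_eval g"
    using assms unfolding hom_poly_fun_def by blast
  \<comment> \<open>Expanding into the monomials \<open>s + t\<close> takes the place of the
    convolution product; degrees add term by term.\<close>
  have "F X * G X = (\<Sum>s\<in>Poly_Mapping.keys f. \<Sum>t\<in>Poly_Mapping.keys g.
      (Poly_Mapping.lookup f s * Poly_Mapping.lookup g t) * mon (s + t) X)" for X
    by (simp add: f g mat_poly_eval_keys sum_product mon_add mult_ac)
  moreover have "hom_poly_fun (d + e) (\<lambda>X. \<Sum>s\<in>Poly_Mapping.keys f. \<Sum>t\<in>Poly_Mapping.keys g.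
      (Poly_Mapping.lookup f s * Poly_Mapping.lookup g t) * mon (s + t) X)"
    using f g
    by (intro hom_poly_fun_sum hom_poly_fun_single)
       (auto simp: homogeneous_of_degree_def lookup_add sum.distrib)
  ultimately show ?thesis by presburger
qed

lemma hom_poly_fun_const: "hom_poly_fun 0 (\<lambda>X. c)"
  using hom_poly_fun_single[of 0 0 c] by (simp add: mon_def case_prod_unfold)

lemma hom_poly_fun_cmult: "hom_poly_fun d F \<Longrightarrow> hom_poly_fun d (\<lambda>X. c * F X)"
  using hom_poly_fun_mult[OF hom_poly_fun_const] by fastforce

lemma hom_poly_fun_diff:
  assumes "hom_poly_fun d F" "hom_poly_fun d G"
  shows "hom_poly_fun d (\<lambda>X. F X - G X)"
  using hom_poly_fun_add[OF assms(1) hom_poly_fun_cmult[OF assms(2), of "-1"]] by simp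

lemma hom_poly_fun_coord: "hom_poly_fun 1 (\<lambda>X. X $ k $ i $ j)"
proof -
  have "mon (Poly_Mapping.single (k, i, j) 1) X = X $ k $ i $ j" for X
  proof -
    have "mon (Poly_Mapping.single (k, i, j) 1) X
        = (\<Prod>v\<in>UNIV. if v = (k, i, j) then X $ k $ i $ j else 1)"
      unfolding mon_def by (intro prod.cong) (auto simp: lookup_single when_def split: if_splits)
    then show ?thesis by simp
  qed
  then show ?thesis
    using hom_poly_fun_single[of "Poly_Mapping.single (k, i, j) 1" 1 1]
    by (simp add: lookup_single when_def)
qed

section \<open>Scaling, differentiability and continuity of polynomial functions\<close>

lemma mat_poly_eval_scale:
  assumes "homogeneous_of_degree d f"
  shows "mat_poly_eval f (\<chi> k i j. c * X $ k $ i $ j) = c ^ d * mat_poly_eval f X"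
proof -
  have "mon t (\<chi> k i j. c * X $ k $ i $ j) = c ^ (\<Sum>v\<in>UNIV. Poly_Mapping.lookup t v) * mon t X" for t
    by (simp add: mon_def case_prod_unfold power_mult_distrib prod.distrib power_sum)
  then show ?thesis
    using assms
    by (auto simp: mat_poly_eval_keys homogeneous_of_degree_def sum_distrib_left mult_ac
        intro!: sum.cong)
qed

lemma mon_differentiable: "mon t differentiable (at X)"
proof -
  have "\<exists>D. ((\<lambda>X. (X $ fst v $ fst (snd v) $ snd (snd v)) ^ Poly_Mapping.lookup t v)
      has_derivative D) (at X)" for v
    by (rule exI) (auto intro!: derivative_eq_intros bounded_linear_imp_has_derivative
        bounded_linear_compose[OF bounded_linear_vec_nth] bounded_linear_vec_nth)
  then obtain D where D: "\<And>v. ((\<lambda>X. (X $ fst v $ fst (snd v) $ snd (snd v)) ^ Poly_Mapping.lookup t v)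
      has_derivative D v) (at X)"
    by metis
  have "mon t = (\<lambda>X. \<Prod>v\<in>UNIV. (X $ fst v $ fst (snd v) $ snd (snd v)) ^ Poly_Mapping.lookup t v)"
    by (simp add: fun_eq_iff mon_def case_prod_unfold)
  then show ?thesis
    unfolding differentiable_def using has_derivative_prod[of UNIV "\<lambda>v X. (X $ fst v $ fst (snd v) $ snd (snd v)) ^ Poly_Mapping.lookup t v", OF D]
    by auto
qed

lemma mat_poly_eval_differentiable: "mat_poly_eval f differentiable (at X)"
proof -
  have "mat_poly_eval f = (\<lambda>X. \<Sum>t\<in>Poly_Mapping.keys f. Poly_Mapping.lookup f t * mon t X)"
    by (simp add: fun_eq_iff mat_poly_eval_keys)
  then show ?thesis
    by (simp add: differentiable_sum differentiable_mult mon_differentiable)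
qed

lemma mat_poly_eval_tendsto:
  assumes "(G \<longlongrightarrow> X) F"
  shows "((\<lambda>t. mat_poly_eval f (G t)) \<longlongrightarrow> mat_poly_eval f X) F"
  using differentiable_imp_continuous_within[OF mat_poly_eval_differentiable] assms
  by (auto intro: isCont_tendsto_compose)

subsection \<open>Spaces of singular matrices\<close>

definition adjugate3 :: "complex^3^3 \<Rightarrow> complex^3^3" where
  "adjugate3 A = vector [
     vector [A$2$2 * A$3$3 - A$2$3 * A$3$2, A$1$3 * A$3$2 - A$1$2 * A$3$3, A$1$2 * A$2$3 - A$1$3 * A$2$2],
     vector [A$2$3 * A$3$1 - A$2$1 * A$3$3, A$1$1 * A$3$3 - A$1$3 * A$3$1, A$1$3 * A$2$1 - A$1$1 * A$2$3],
     vector [A$2$1 * A$3$2 - A$2$2 * A$3$1, A$1$2 * A$3$1 - A$1$1 * A$3$2, A$1$1 * A$2$2 - A$1$2 * A$2$1]]"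

text \<open>\<open>adj(P A) P = adj(A) adj(P) P = det P adj(A)\<close>, a form that involves no
  inverse of \<open>P\<close>.\<close>

lemma adjugate3_left: "adjugate3 (P ** A) ** P = (\<chi> i j. det P * adjugate3 A $ i $ j)"
  by (simp add: vec_eq_iff forall_3 adjugate3_def vector_3 matrix_matrix_mult_def sum_3 det_3)
     (algebra)

lemma adjugate3_right: "Q ** adjugate3 (A ** Q) = (\<chi> i j. det Q * adjugate3 A $ i $ j)"
  by (simp add: vec_eq_iff forall_3 adjugate3_def vector_3 matrix_matrix_mult_def sum_3 det_3)
     (algebra)

text \<open>
  Under \<open>Y \<mapsto> P Y Q\<close> with \<open>det P = det Q = 1\<close> the adjugate of \<open>Y\<close> is multiplied by the inverses of
  \<open>Q\<close> and \<open>P\<close>, so the products \<open>A adj(B)\<close> are merely conjugated by \<open>P\<close>.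
\<close>

definition deg6_form :: "complex^3^3 \<Rightarrow> complex^3^3 \<Rightarrow> complex^3^3 \<Rightarrow> complex^3^3 \<Rightarrow> complex" where
  "deg6_form A B C D = trace (A ** adjugate3 B ** C ** adjugate3 D)"

lemma deg6_form_equivalence:
  "deg6_form (P ** A ** Q) (P ** B ** Q) (P ** C ** Q) (P ** D ** Q) = (det P * det Q)\<^sup>2 * deg6_form A B C D"
proof -
  have *: "Q ** adjugate3 (P ** Y ** Q) ** P = (\<chi> i j. (det P * det Q) * adjugate3 Y $ i $ j)" for Y
  proof -
    have "Q ** adjugate3 (P ** Y ** Q) ** P = (\<chi> i j. det Q * adjugate3 (P ** Y) $ i $ j) ** P"
      by (simp add: adjugate3_right)
    also have "\<dots> = (\<chi> i j. det Q * (adjugate3 (P ** Y) ** P) $ i $ j)"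
      by (simp add: vec_eq_iff matrix_matrix_mult_def sum_distrib_left mult_ac)
    finally show ?thesis by (simp add: adjugate3_left mult_ac)
  qed
  have "deg6_form (P ** A ** Q) (P ** B ** Q) (P ** C ** Q) (P ** D ** Q)
      = trace (P ** (A ** (Q ** adjugate3 (P ** B ** Q) ** P) ** C ** (Q ** adjugate3 (P ** D ** Q))))"
    by (simp add: deg6_form_def matrix_mul_assoc)
  \<comment> \<open>Cyclicity of the trace moves the leading \<open>P\<close> to the end, so that
    each adjugate stands between \<open>Q\<close> and \<open>P\<close>.\<close>
  also have "\<dots> = trace (A ** (Q ** adjugate3 (P ** B ** Q) ** P) ** C ** (Q ** adjugate3 (P ** D ** Q) ** P))"
    by (subst trace_mul_sym) (simp add: matrix_mul_assoc)
  also have "\<dots> = (det P * det Q)\<^sup>2 * deg6_form A B C D"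
    unfolding * deg6_form_def
    by (simp add: trace_def matrix_matrix_mult_def sum_distrib_left sum_distrib_right power2_eq_square mult_ac)
  finally show ?thesis .
qed

text \<open>
  The Hilbert--Mumford condition for the span of the tuple: in suitable bases, a one-parameter
  subgroup of diagonal matrices with exponents \<open>a\<close> and \<open>b\<close> contracts all of \<open>V\<close> to zero.
\<close>

definition compressible :: "(complex^'n^'n) set \<Rightarrow> bool" where
  "compressible V \<longleftrightarrow> (\<exists>P Q (a :: 'n::finite \<Rightarrow> int) b. det P \<noteq> 0 \<and> det Q \<noteq> 0 \<and> sum a UNIV = 0 \<and> sum b UNIV = 0 \<and>
     (\<forall>Y\<in>V. \<forall>i j. (P ** Y ** Q) $ i $ j \<noteq> 0 \<longrightarrow> a i + b j > 0))"

lemma compressible_equivalence: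
  assumes "compressible ((\<lambda>Y. P ** Y ** Q) ` V)" "det P \<noteq> 0" "det Q \<noteq> 0"
  shows "compressible V"
proof -
  obtain P' Q' a b where *: "det P' \<noteq> 0" "det Q' \<noteq> 0" "sum a UNIV = 0" "sum b UNIV = (0::int)"
    "\<And>Y i j. Y \<in> V \<Longrightarrow> (P' ** (P ** Y ** Q) ** Q') $ i $ j \<noteq> 0 \<Longrightarrow> a i + b j > 0"
    using assms(1) unfolding compressible_def by blast
  show ?thesis
    unfolding compressible_def
    by (rule exI[of _ "P' ** P"], rule exI[of _ "Q ** Q'"], rule exI[of _ a], rule exI[of _ b])
       (use * assms(2,3) in \<open>auto simp: det_mul matrix_mul_assoc\<close>)
qed

text \<open>Row weights \<open>0\<close> and column weights \<open>1, 1, -2\<close>: only the third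
  column has a total weight that is not positive.\<close>

lemma compressible_zero_column:
  fixes V :: "(complex^3^3) set"
  assumes "\<And>Y. Y \<in> V \<Longrightarrow> \<forall>i. Y $ i $ 3 = 0"
  shows "compressible V"
  unfolding compressible_def
  by (rule exI[of _ "mat 1"], rule exI[of _ "mat 1"], rule exI[of _ "\<lambda>i. 0"],
      rule exI[of _ "\<lambda>j. if j = 3 then -2 else 1"])
     (use assms in \<open>auto simp: sum_3\<close>)

lemma compressible_zero_row:
  fixes V :: "(complex^3^3) set"
  assumes "\<And>Y. Y \<in> V \<Longrightarrow> \<forall>j. Y $ 3 $ j = 0"
  shows "compressible V"
  unfolding compressible_def
  by (rule exI[of _ "mat 1"], rule exI[of _ "mat 1"], rule exI[of _ "\<lambda>j. if j = 3 then -2 else 1"],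
      rule exI[of _ "\<lambda>i. 0"])
     (use assms in \<open>auto simp: sum_3\<close>)

text \<open>With weights \<open>2, -1, -1\<close> on rows and columns the total is 4 or 1 as soon as
  the row or the column is the first one, and -2 on the block.\<close>

lemma compressible_zero_block:
  fixes V :: "(complex^3^3) set"
  assumes "\<And>Y i j. Y \<in> V \<Longrightarrow> i \<noteq> 1 \<Longrightarrow> j \<noteq> 1 \<Longrightarrow> Y $ i $ j = 0"
  shows "compressible V"
  unfolding compressible_def
  by (rule exI[of _ "mat 1"], rule exI[of _ "mat 1"], rule exI[of _ "\<lambda>i. if i = 1 then 2 else -1"],
      rule exI[of _ "\<lambda>i. if i = 1 then 2 else -1"])
     (use assms in \<open>auto simp: sum_3\<close>)

text \<open>If neither factor vanished on \<open>V\<close>, the sum of a point with \<open>f\<close>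
  nonzero and a point with \<open>g\<close> nonzero would make both factors nonzero.\<close>

lemma additive_product_zero:
  fixes f g :: "'a::real_vector \<Rightarrow> 'b::idom"
  assumes V: "subspace V"
    and f: "\<And>x y. f (x + y) = f x + f y" and g: "\<And>x y. g (x + y) = g x + g y"
    and 0: "\<And>x. x \<in> V \<Longrightarrow> f x * g x = 0"
  shows "(\<forall>x\<in>V. f x = 0) \<or> (\<forall>x\<in>V. g x = 0)"
proof (rule ccontr)
  assume "\<not> ?thesis"
  then obtain x y where xy: "x \<in> V" "f x \<noteq> 0" "y \<in> V" "g y \<noteq> 0"
    by blast
  then have "g x = 0" "f y = 0"
    using 0 by force+
  then show False
    using 0[OF subspace_add[OF V xy(1) xy(3)]] xy by (simp add: f g)
qed

text \<open>The product of two of the factors is not additive, so the case of two factors cannot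
  simply be iterated; the third factor is handled along a line through a point where the other two
  are nonzero.\<close>

lemma additive_product3_zero:
  fixes f g h :: "'a::real_vector \<Rightarrow> complex"
  assumes V: "subspace V"
    and f: "\<And>x y. f (x + y) = f x + f y" and g: "\<And>x y. g (x + y) = g x + g y"
    and h: "\<And>x y. h (x + y) = h x + h y"
    and 0: "\<And>x. x \<in> V \<Longrightarrow> f x * (g x * h x) = 0"
  shows "(\<forall>x\<in>V. f x = 0) \<or> (\<forall>x\<in>V. g x = 0) \<or> (\<forall>x\<in>V. h x = 0)"
proof (rule disjCI)
  assume "\<not> ((\<forall>x\<in>V. g x = 0) \<or> (\<forall>x\<in>V. h x = 0))"
  then obtain b where b: "b \<in> V" "g b * h b \<noteq> 0"
    using additive_product_zero[OF V g h] by blast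
  show "\<forall>x\<in>V. f x = 0"
  proof (rule ccontr)
    assume "\<not> ?thesis"
    then obtain a where a: "a \<in> V" "f a \<noteq> 0"
      by blast
    have fb: "f b = 0"
      using 0[OF b(1)] b(2) by simp
    have diff: "f (x - y) = f x - f y" "g (x - y) = g x - g y" "h (x - y) = h x - h y" for x y
      using f[of "x - y" y] g[of "x - y" y] h[of "x - y" y] by (simp_all add: algebra_simps)
    have "b + a \<in> V" "b - a \<in> V" "b + a + a \<in> V"
      using a b by (simp_all add: V subspace_add subspace_diff)
    \<comment> \<open>The quadratic polynomial \<open>g (b + t a) h (b + t a)\<close> vanishes at \<open>t = 1, -1, 2\<close>, hence at \<open>t = 0\<close>.\<close>
    then have "(g b + g a) * (h b + h a) = 0" "(g b - g a) * (h b - h a) = 0"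
      "(g b + g a + g a) * (h b + h a + h a) = 0"
      using 0[of "b + a"] 0[of "b - a"] 0[of "b + a + a"] a(2) fb
      by (auto simp: f g h diff simp del: mult_eq_0_iff)
    then have "3 * (g b * h b) = 0"
      by algebra
    with b(2) show False by simp
  qed
qed

lemma ex_linear_comb_eq_1:
  fixes x y :: "'a::field"
  assumes "x \<noteq> 0 \<or> y \<noteq> 0"
  shows "\<exists>u v. u * x + v * y = 1"
proof (cases "x = 0")
  case True
  with assms show ?thesis by (intro exI[of _ 0] exI[of _ "1 / y"]) simp
next
  case False
  then show ?thesis by (intro exI[of _ "1 / x"] exI[of _ 0]) simp
qed

section \<open>Compressibility from a normal form of rank 2 or 1\<close>

lemma det_matrix_rows3:
  "det (vector [vector [a, b, c], vector [d, e, f], vector [g, h, i]] :: complex^3^3)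
    = a * e * i + b * f * g + c * d * h - a * f * h - b * d * i - c * e * g"
  by (simp add: det_3)

text \<open>Let \<open>M\<close> be the upper left 2 by 2 block of \<open>Y\<close>. The border
  column is \<open>f Y\<close> times \<open>(x, y)\<close>, the border row is \<open>g Y\<close>
  times \<open>(y, -x)\<close>, and \<open>det Y = f Y * g Y * h Y\<close> with
  \<open>h Y = (y, -x) M (x, y)\<close>. So one of these linear forms vanishes on \<open>V\<close>;
  they give a zero column, a zero row and a block of zeros, respectively.\<close>

lemma compressible_of_parallel_borders:
  fixes V :: "(complex^3^3) set"
  assumes V: "subspace V" and det0: "\<And>Y. Y \<in> V \<Longrightarrow> det Y = 0"
    and corner: "\<And>Y. Y \<in> V \<Longrightarrow> Y $ 3 $ 3 = 0"
    and xy: "x \<noteq> 0 \<or> y \<noteq> 0"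
    and col: "\<And>Y. Y \<in> V \<Longrightarrow> Y $ 1 $ 3 * y = Y $ 2 $ 3 * x"
    and row: "\<And>Y. Y \<in> V \<Longrightarrow> Y $ 3 $ 1 * x + Y $ 3 $ 2 * y = 0"
  shows "compressible V"
proof -
  obtain u v where uv: "u * x + v * y = 1"
    using ex_linear_comb_eq_1[OF xy] by blast
  define f where "f = (\<lambda>Y::complex^3^3. u * Y $ 1 $ 3 + v * Y $ 2 $ 3)"
  define g where "g = (\<lambda>Y::complex^3^3. Y $ 3 $ 1 * v - Y $ 3 $ 2 * u)"
  define h where "h = (\<lambda>Y::complex^3^3. y * (Y $ 1 $ 1 * x + Y $ 1 $ 2 * y) - x * (Y $ 2 $ 1 * x + Y $ 2 $ 2 * y))"
  have b: "Y $ 1 $ 3 = f Y * x" "Y $ 2 $ 3 = f Y * y" if "Y \<in> V" for Y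
    using col[OF that] uv unfolding f_def by algebra+
  have c: "Y $ 3 $ 1 = g Y * y" "Y $ 3 $ 2 = - g Y * x" if "Y \<in> V" for Y
    using row[OF that] uv unfolding g_def by algebra+
  have "f Y * (g Y * h Y) = 0" if "Y \<in> V" for Y
    using det0[OF that] unfolding h_def
    by (simp add: det_3 corner[OF that] b[OF that] c[OF that]) algebra
  then have "(\<forall>Y\<in>V. f Y = 0) \<or> (\<forall>Y\<in>V. g Y = 0) \<or> (\<forall>Y\<in>V. h Y = 0)"
    by (intro additive_product3_zero[OF V]) (simp_all add: f_def g_def h_def algebra_simps)
  then consider "\<forall>Y\<in>V. f Y = 0" | "\<forall>Y\<in>V. g Y = 0" | "\<forall>Y\<in>V. h Y = 0" by blast
  then show ?thesis
  proof cases
    case 1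
    then show ?thesis
      using b corner by (intro compressible_zero_column) (auto simp: forall_3)
  next
    case 2
    then show ?thesis
      using c corner by (intro compressible_zero_row) (auto simp: forall_3)
  next
    case 3
    \<comment> \<open>The second row of \<open>P\<close> is \<open>(y, -x, 0)\<close> and the second
      column of \<open>Q\<close> is \<open>(x, y, 0)\<close>, so the four lower right entries of
      \<open>P ** Y ** Q\<close> are \<open>h Y\<close>, the two expressions in \<open>col\<close>
      and \<open>row\<close>, and the corner. The entries \<open>u\<close>, \<open>v\<close> only
      serve to make the determinants -1 and 1.\<close>
    define P :: "complex^3^3" where
      "P = vector [vector [u, v, 0], vector [y, -x, 0], vector [0, 0, 1]]"
    define Q :: "complex^3^3" where
      "Q = vector [vector [v, x, 0], vector [-u, y, 0], vector [0, 0, 1]]"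
    have detPQ: "det P \<noteq> 0" "det Q \<noteq> 0"
    proof -
      have "det P = -1" "det Q = 1"
        using uv unfolding P_def Q_def det_matrix_rows3 by algebra+
      then show "det P \<noteq> 0" "det Q \<noteq> 0" by auto
    qed
    have "(P ** Y ** Q) $ i $ j = 0" if Y: "Y \<in> V" and ij: "i \<noteq> 1" "j \<noteq> 1" for Y i j
    proof -
      have "i = 2 \<or> i = 3" "j = 2 \<or> j = 3" using ij exhaust_3 by metis+
      moreover have "h Y = 0" using 3 Y by blast
      ultimately show ?thesis
        unfolding P_def Q_def h_def
        using corner[OF Y] col[OF Y] row[OF Y]
        by (elim disjE) (simp_all add: matrix_matrix_mult_def sum_3 algebra_simps)
    qed
    then show ?thesis
      by (intro compressible_equivalence[OF compressible_zero_block detPQ]) auto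
  qed
qed

lemma compressible_of_rank2:
  fixes V :: "(complex^3^3) set"
  assumes V: "subspace V" and det0: "\<And>Y. Y \<in> V \<Longrightarrow> det Y = 0"
    and form0: "\<And>A B C D. A \<in> V \<Longrightarrow> B \<in> V \<Longrightarrow> C \<in> V \<Longrightarrow> D \<in> V \<Longrightarrow> deg6_form A B C D = 0"
    and E: "vector [vector [1, 0, 0], vector [0, 1, 0], vector [0, 0, 0]] \<in> V" (is "?E \<in> V")
  shows "compressible V"
proof -
  \<comment> \<open>\<open>det (Y + t E)\<close> is quadratic in \<open>t\<close>. Its values at 0,
    1 and -1 isolate the leading coefficient, which is the corner entry, and then the linear one,
    which is minus the product of border row and border column.\<close>
  have pencil: "Y $ 3 $ 3 = 0 \<and> Y $ 3 $ 1 * Y $ 1 $ 3 + Y $ 3 $ 2 * Y $ 2 $ 3 = 0" if Y: "Y \<in> V" for Y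
  proof -
    have "det Y = 0" "det (Y + ?E) = 0" "det (Y - ?E) = 0"
      using Y E by (auto intro!: det0 subspace_add[OF V] subspace_diff[OF V])
    then have d: "Y$1$1 * Y$2$2 * Y$3$3 + Y$1$2 * Y$2$3 * Y$3$1 + Y$1$3 * Y$2$1 * Y$3$2
        - Y$1$1 * Y$2$3 * Y$3$2 - Y$1$2 * Y$2$1 * Y$3$3 - Y$1$3 * Y$2$2 * Y$3$1 = 0"
      "(Y$1$1 + 1) * (Y$2$2 + 1) * Y$3$3 + Y$1$2 * Y$2$3 * Y$3$1 + Y$1$3 * Y$2$1 * Y$3$2
        - (Y$1$1 + 1) * Y$2$3 * Y$3$2 - Y$1$2 * Y$2$1 * Y$3$3 - Y$1$3 * (Y$2$2 + 1) * Y$3$1 = 0"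
      "(Y$1$1 - 1) * (Y$2$2 - 1) * Y$3$3 + Y$1$2 * Y$2$3 * Y$3$1 + Y$1$3 * Y$2$1 * Y$3$2
        - (Y$1$1 - 1) * Y$2$3 * Y$3$2 - Y$1$2 * Y$2$1 * Y$3$3 - Y$1$3 * (Y$2$2 - 1) * Y$3$1 = 0"
      unfolding det_3 by (simp_all only: vector_add_component vector_minus_component vector_3 add_0_right diff_0_right)
    have "2 * Y $ 3 $ 3 = 0"
      using d by algebra
    moreover have "2 * (Y $ 1 $ 1 * Y $ 3 $ 3 + Y $ 2 $ 2 * Y $ 3 $ 3
        - Y $ 3 $ 1 * Y $ 1 $ 3 - Y $ 3 $ 2 * Y $ 2 $ 3) = 0"
      using d by algebra
    ultimately have "Y $ 3 $ 3 = 0" "Y $ 3 $ 1 * Y $ 1 $ 3 + Y $ 3 $ 2 * Y $ 2 $ 3 = 0"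
      by algebra+
    then show ?thesis by simp
  qed
  \<comment> \<open>As \<open>adj(E)\<close> is the matrix unit at \<open>(3, 3)\<close>, the form
    is the third row of \<open>C\<close> times \<open>adj(D)\<close> times the third column of
    \<open>A\<close>. Since \<open>D\<close> has corner 0, the upper left block of
    \<open>adj(D)\<close> has rank at most 1, and the value splits into two 2 by 2 minors.\<close>
  have form: "(C $ 3 $ 1 * D $ 3 $ 2 - C $ 3 $ 2 * D $ 3 $ 1) * (A $ 1 $ 3 * D $ 2 $ 3 - A $ 2 $ 3 * D $ 1 $ 3) = 0"
    if "A \<in> V" "C \<in> V" "D \<in> V" for A C D
    using form0[OF that(1) E that(2,3)] pencil[OF that(1)] pencil[OF that(2)] pencil[OF that(3)]
    by (simp add: deg6_form_def trace_def adjugate3_def matrix_matrix_mult_def sum_3 del: mult_eq_0_iff)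
       algebra
  let ?br = "\<lambda>A D. A $ 1 $ 3 * D $ 2 $ 3 - A $ 2 $ 3 * D $ 1 $ 3"
  let ?cr = "\<lambda>C D. C $ 3 $ 1 * D $ 3 $ 2 - C $ 3 $ 2 * D $ 3 $ 1"
  \<comment> \<open>For fixed \<open>A\<close> and \<open>C\<close> both minors are additive in the
    remaining argument, so the sum \<open>D + D'\<close> leads to a contradiction as in
    \<open>additive_product_zero\<close>.\<close>
  have "(\<forall>A\<in>V. \<forall>D\<in>V. ?br A D = 0) \<or> (\<forall>C\<in>V. \<forall>D\<in>V. ?cr C D = 0)"
  proof (rule ccontr)
    assume "\<not> ?thesis"
    then obtain A D C D' where *: "A \<in> V" "D \<in> V" "?br A D \<noteq> 0" "C \<in> V" "D' \<in> V" "?cr C D' \<noteq> 0"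
      by blast
    have "?cr C D * ?br A D = 0" "?cr C D' * ?br A D' = 0"
      using form[OF *(1) *(4) *(2)] form[OF *(1) *(4) *(5)] by blast+
    then have "?cr C D = 0" "?br A D' = 0"
      using * by auto
    moreover have "?cr C (D + D') * ?br A (D + D') = 0"
      using * by (intro form subspace_add[OF V])
    then have "(?cr C D + ?cr C D') * (?br A D + ?br A D') = 0"
      by (simp add: algebra_simps)
    ultimately show False
      using * by simp
  qed
  then show ?thesis
  proof
    assume br: "\<forall>A\<in>V. \<forall>D\<in>V. ?br A D = 0"
    show ?thesis
    proof (cases "\<forall>Y\<in>V. Y $ 1 $ 3 = 0 \<and> Y $ 2 $ 3 = 0")
      case True
      then show ?thesis
        using pencil by (intro compressible_zero_column) (auto simp: forall_3)
    next
      case False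
      then obtain A where A: "A \<in> V" "A $ 1 $ 3 \<noteq> 0 \<or> A $ 2 $ 3 \<noteq> 0"
        by blast
      define x y where "x = A $ 1 $ 3" and "y = A $ 2 $ 3"
      obtain u v where uv: "u * x + v * y = 1"
        using ex_linear_comb_eq_1[of x y] A(2) by (auto simp: x_def y_def)
      have col: "Y $ 1 $ 3 * y = Y $ 2 $ 3 * x" if "Y \<in> V" for Y
        using br A(1) that unfolding x_def y_def by force
      \<comment> \<open>All border columns are multiples of the column \<open>(x, y)\<close> of
        \<open>A\<close>, with factor \<open>?f Y\<close>, so the pencil relation reads
        \<open>?f Y * ?g Y = 0\<close>; and \<open>?f A = 1\<close>.\<close>
      let ?f = "\<lambda>Y::complex^3^3. u * Y $ 1 $ 3 + v * Y $ 2 $ 3"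
      let ?g = "\<lambda>Y::complex^3^3. Y $ 3 $ 1 * x + Y $ 3 $ 2 * y"
      have "?f Y * ?g Y = 0" if "Y \<in> V" for Y
        using pencil[OF that] col[OF that] uv by algebra
      then have "(\<forall>Y\<in>V. ?f Y = 0) \<or> (\<forall>Y\<in>V. ?g Y = 0)"
        by (intro additive_product_zero[OF V]) (simp_all add: algebra_simps)
      moreover have "?f A \<noteq> 0"
        using uv by (simp add: x_def y_def)
      ultimately have "\<forall>Y\<in>V. ?g Y = 0"
        using A(1) by blast
      then show ?thesis
        using A(2) col pencil
        by (intro compressible_of_parallel_borders[OF V det0, where x = x and y = y])
           (auto simp: x_def y_def)
    qed
  next
    assume cr: "\<forall>C\<in>V. \<forall>D\<in>V. ?cr C D = 0"
    show ?thesis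
    proof (cases "\<forall>Y\<in>V. Y $ 3 $ 1 = 0 \<and> Y $ 3 $ 2 = 0")
      case True
      then show ?thesis
        using pencil by (intro compressible_zero_row) (auto simp: forall_3)
    next
      case False
      then obtain C where C: "C \<in> V" "C $ 3 $ 1 \<noteq> 0 \<or> C $ 3 $ 2 \<noteq> 0"
        by blast
      \<comment> \<open>The vector \<open>(x, y)\<close> is orthogonal to the border row of
        \<open>C\<close>, hence to all border rows.\<close>
      define x y where "x = C $ 3 $ 2" and "y = - C $ 3 $ 1"
      obtain u v where uv: "u * x + v * y = 1"
        using ex_linear_comb_eq_1[of x y] C(2) by (auto simp: x_def y_def)
      have row: "Y $ 3 $ 1 * x + Y $ 3 $ 2 * y = 0" if "Y \<in> V" for Y
        using cr C(1) that unfolding x_def y_def by force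
      let ?f = "\<lambda>Y::complex^3^3. u * Y $ 3 $ 2 - v * Y $ 3 $ 1"
      let ?g = "\<lambda>Y::complex^3^3. Y $ 1 $ 3 * y - Y $ 2 $ 3 * x"
      have "?f Y * ?g Y = 0" if "Y \<in> V" for Y
        using pencil[OF that] row[OF that] uv by algebra
      then have "(\<forall>Y\<in>V. ?f Y = 0) \<or> (\<forall>Y\<in>V. ?g Y = 0)"
        by (intro additive_product_zero[OF V]) (simp_all add: algebra_simps)
      moreover have "?f C \<noteq> 0"
        using uv by (simp add: x_def y_def)
      ultimately have "\<forall>Y\<in>V. ?g Y = 0"
        using C(1) by blast
      then show ?thesis
        using C(2) row pencil
        by (intro compressible_of_parallel_borders[OF V det0, where x = x and y = y])
           (auto simp: x_def y_def)
    qed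
  qed
qed

text \<open>Adding \<open>E\<close> changes each 2 by 2 minor through position \<open>(1, 1)\<close>
  by one entry of the lower right block, so this block vanishes. The minor on rows and columns 1 and
  3 then leaves a product of two linear forms.\<close>

lemma compressible_of_rank1:
  fixes V :: "(complex^3^3) set"
  assumes V: "subspace V" and adj0: "\<And>Y. Y \<in> V \<Longrightarrow> adjugate3 Y = 0"
    and E: "vector [vector [1, 0, 0], vector [0, 0, 0], vector [0, 0, 0]] \<in> V" (is "?E \<in> V")
  shows "compressible V"
proof -
  have adj: "adjugate3 Y $ i $ j = 0" if "Y \<in> V" for Y i j
    using adj0[OF that] by simp
  have block: "Y $ 2 $ 2 = 0 \<and> Y $ 2 $ 3 = 0 \<and> Y $ 3 $ 2 = 0 \<and> Y $ 3 $ 3 = 0" if "Y \<in> V" for Y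
  proof -
    have "Y + ?E \<in> V"
      using that E by (rule subspace_add[OF V])
    from adj[OF this, of 3 3] adj[OF this, of 3 2] adj[OF this, of 2 3] adj[OF this, of 2 2]
    have "(Y$1$1 + 1) * Y$2$2 - Y$1$2 * Y$2$1 = 0" "Y$1$2 * Y$3$1 - (Y$1$1 + 1) * Y$3$2 = 0"
      "Y$1$3 * Y$2$1 - (Y$1$1 + 1) * Y$2$3 = 0" "(Y$1$1 + 1) * Y$3$3 - Y$1$3 * Y$3$1 = 0"
      by (simp_all only: adjugate3_def vector_add_component vector_3 add_0_right)
    moreover from adj[OF that, of 3 3] adj[OF that, of 3 2] adj[OF that, of 2 3] adj[OF that, of 2 2]
    have "Y$1$1 * Y$2$2 - Y$1$2 * Y$2$1 = 0" "Y$1$2 * Y$3$1 - Y$1$1 * Y$3$2 = 0"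
      "Y$1$3 * Y$2$1 - Y$1$1 * Y$2$3 = 0" "Y$1$1 * Y$3$3 - Y$1$3 * Y$3$1 = 0"
      by (simp_all only: adjugate3_def vector_3)
    ultimately show ?thesis
      by (intro conjI) algebra+
  qed
  have "Y $ 1 $ 3 * Y $ 3 $ 1 = 0" if "Y \<in> V" for Y
    using adj[OF that, of 2 2] block[OF that] by (simp add: adjugate3_def)
  then have "(\<forall>Y\<in>V. Y $ 1 $ 3 = 0) \<or> (\<forall>Y\<in>V. Y $ 3 $ 1 = 0)"
    by (intro additive_product_zero[OF V]) (simp_all add: algebra_simps)
  then show ?thesis
  proof
    assume "\<forall>Y\<in>V. Y $ 1 $ 3 = 0"
    then show ?thesis
      using block by (intro compressible_zero_column) (auto simp: forall_3)
  next
    assume "\<forall>Y\<in>V. Y $ 3 $ 1 = 0"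
    then show ?thesis
      using block by (intro compressible_zero_row) (auto simp: forall_3)
  qed
qed

section \<open>Normal forms and reduction to them\<close>

lemma adjugate3_mult: "adjugate3 (A ** B) = adjugate3 B ** adjugate3 A"
  by (simp add: vec_eq_iff forall_3 adjugate3_def vector_3 matrix_matrix_mult_def sum_3 algebra_simps)

lemma rank1_normal_form:
  fixes Z :: "complex^3^3"
  assumes adj0: "adjugate3 Z = 0" and "Z $ 1 $ 1 \<noteq> 0"
  shows "\<exists>P Q. det P \<noteq> 0 \<and> det Q \<noteq> 0 \<and>
    P ** Z ** Q = vector [vector [1, 0, 0], vector [0, 0, 0], vector [0, 0, 0]]"
proof -
  \<comment> \<open>Gaussian elimination with pivot \<open>(1, 1)\<close>; the vanishing minors say
    that nothing is left in the lower right block.\<close>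
  let ?P = "vector [vector [1 / Z$1$1, 0, 0], vector [- Z$2$1 / Z$1$1, 1, 0],
    vector [- Z$3$1 / Z$1$1, 0, 1]] :: complex^3^3"
  let ?Q = "vector [vector [1, - Z$1$2 / Z$1$1, - Z$1$3 / Z$1$1], vector [0, 1, 0],
    vector [0, 0, 1]] :: complex^3^3"
  have "adjugate3 Z $ i $ j = 0" for i j
    using adj0 by simp
  from this[of 3 3] this[of 3 2] this[of 2 3] this[of 2 2]
  have "Z$1$1 * Z$2$2 - Z$1$2 * Z$2$1 = 0" "Z$1$2 * Z$3$1 - Z$1$1 * Z$3$2 = 0"
    "Z$1$3 * Z$2$1 - Z$1$1 * Z$2$3 = 0" "Z$1$1 * Z$3$3 - Z$1$3 * Z$3$1 = 0"
    by (simp_all only: adjugate3_def vector_3)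
  then have "?P ** Z ** ?Q = vector [vector [1, 0, 0], vector [0, 0, 0], vector [0, 0, 0]]"
    using assms(2)
    by (simp add: vec_eq_iff forall_3 matrix_matrix_mult_def sum_3 field_simps)
  moreover have "det ?P \<noteq> 0" "det ?Q \<noteq> 0"
    using assms(2) by (simp_all add: det_matrix_rows3)
  ultimately show ?thesis by blast
qed

lemma rank2_normal_form:
  fixes Z :: "complex^3^3"
  assumes det0: "det Z = 0" and adj: "adjugate3 Z $ 3 $ 3 \<noteq> 0"
  shows "\<exists>P Q. det P \<noteq> 0 \<and> det Q \<noteq> 0 \<and>
    P ** Z ** Q = vector [vector [1, 0, 0], vector [0, 1, 0], vector [0, 0, 0]]"
proof -
  define m where "m = Z$1$1 * Z$2$2 - Z$1$2 * Z$2$1"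
  have m: "m \<noteq> 0"
    using adj by (simp add: m_def adjugate3_def)
  \<comment> \<open>The first two rows hold the inverse of the upper left block of \<open>Z\<close>.
    The third is the third row of \<open>adj(Z)\<close>, which annihilates \<open>Z\<close> because
    \<open>adj(Z) Z = det Z = 0\<close>. Then \<open>?Q\<close> clears the third column.\<close>
  let ?P = "vector [vector [Z$2$2 / m, - Z$1$2 / m, 0], vector [- Z$2$1 / m, Z$1$1 / m, 0],
    vector [Z$2$1 * Z$3$2 - Z$2$2 * Z$3$1, Z$1$2 * Z$3$1 - Z$1$1 * Z$3$2, m]] :: complex^3^3"
  let ?Q = "vector [vector [1, 0, (Z$1$2 * Z$2$3 - Z$1$3 * Z$2$2) / m],
    vector [0, 1, (Z$1$3 * Z$2$1 - Z$1$1 * Z$2$3) / m], vector [0, 0, 1]] :: complex^3^3"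
  have "?P ** Z = vector [vector [1, 0, (Z$2$2 * Z$1$3 - Z$1$2 * Z$2$3) / m],
      vector [0, 1, (Z$1$1 * Z$2$3 - Z$2$1 * Z$1$3) / m], vector [0, 0, 0]]"
    using m det0 unfolding det_3
    by (simp add: vec_eq_iff forall_3 matrix_matrix_mult_def sum_3 divide_simps)
       (simp add: m_def algebra_simps)
  moreover have "vector [vector [1, 0, (Z$2$2 * Z$1$3 - Z$1$2 * Z$2$3) / m],
      vector [0, 1, (Z$1$1 * Z$2$3 - Z$2$1 * Z$1$3) / m], vector [0, 0, 0]] ** ?Q
      = (vector [vector [1, 0, 0], vector [0, 1, 0], vector [0, 0, 0]] :: complex^3^3)"
    by (simp add: vec_eq_iff forall_3 matrix_matrix_mult_def sum_3 diff_divide_distrib)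
  ultimately have "?P ** Z ** ?Q = vector [vector [1, 0, 0], vector [0, 1, 0], vector [0, 0, 0]]"
    by (simp only:)
  moreover have "det ?P = 1" "det ?Q = 1"
    using m by (simp_all add: det_matrix_rows3 divide_simps) (simp add: m_def algebra_simps)
  ultimately show ?thesis
    by (intro exI[of _ ?P] exI[of _ ?Q]) simp
qed

text \<open>Moves a nonzero entry, or a nonzero minor, to the pivot position that the normal forms
  require.\<close>

lemma transposition_matrix:
  fixes i k :: "'n::finite"
  shows "\<exists>P :: complex^'n^'n. P ** P = mat 1 \<and> det P \<noteq> 0 \<and>
    (\<forall>(Y :: complex^'n^'n) j. (P ** Y) $ k $ j = Y $ i $ j) \<and> (\<forall>(Y :: complex^'n^'n) j. (Y ** P) $ j $ k = Y $ j $ i)"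
proof -
  define p where "p = Transposition.transpose k i"
  define P :: "complex^'n^'n" where "P = (\<chi> r c. if c = p r then 1 else 0)"
  have p: "p (p r) = r" "p k = i" "c = p r \<longleftrightarrow> r = p c" for r c
    by (auto simp: p_def)
  have left: "(P ** Y) $ r $ c = Y $ p r $ c" for Y r c
    by (simp add: matrix_matrix_mult_def P_def if_distrib[of "\<lambda>x. x * _"] cong: if_cong)
  have right: "(Y ** P) $ r $ c = Y $ r $ p c" for Y r c
    by (simp add: matrix_matrix_mult_def P_def p(3)[of c] if_distrib[of "\<lambda>x. _ * x"] cong: if_cong)
  have PP: "P ** P = mat 1"
    by (simp add: vec_eq_iff left) (simp add: P_def mat_def p(1) eq_commute)
  then have "det P * det P = 1"
    by (metis det_I det_mul)
  then have "det P \<noteq> 0" by auto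
  then show ?thesis
    using PP left right p(2) by (intro exI[of _ P]) auto
qed

lemma subspace_equivalence:
  fixes V :: "(complex^'n^'n) set"
  assumes "subspace V"
  shows "subspace ((\<lambda>Y. P ** Y ** Q) ` V)"
proof (rule linear_subspace_image[OF _ assms])
  show "linear (\<lambda>Y. P ** Y ** Q)"
    by (rule linearI)
       (simp_all add: vec_eq_iff matrix_matrix_mult_def distrib_left distrib_right sum.distrib
         scaleR_sum_right sum_distrib_right)
qed

text \<open>If all adjugates vanish, ranks are at most 1; otherwise a singular matrix with nonzero
  adjugate has rank 2. The assumptions survive a change of bases that brings such a matrix to normal
  form.\<close>

lemma compressible_of_singular:
  fixes V :: "(complex^3^3) set"
  assumes V: "subspace V" and det0: "\<And>Y. Y \<in> V \<Longrightarrow> det Y = 0"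
    and form0: "\<And>A B C D. A \<in> V \<Longrightarrow> B \<in> V \<Longrightarrow> C \<in> V \<Longrightarrow> D \<in> V \<Longrightarrow> deg6_form A B C D = 0"
  shows "compressible V"
proof (cases "\<forall>Y\<in>V. adjugate3 Y = 0")
  case adj0: True
  show ?thesis
  proof (cases "\<forall>Y\<in>V. Y = 0")
    case True
    then show ?thesis
      by (intro compressible_zero_row) auto
  next
    case False
    then obtain Z i j where Z: "Z \<in> V" "Z $ i $ j \<noteq> 0"
      by (auto simp: vec_eq_iff)
    obtain P1 where P1: "det P1 \<noteq> 0" "\<And>(Y :: complex^3^3) l. (P1 ** Y) $ 1 $ l = Y $ i $ l"
      using transposition_matrix[where k = 1 and i = i] by blast
    obtain Q1 where Q1: "det Q1 \<noteq> 0" "\<And>(Y :: complex^3^3) l. (Y ** Q1) $ l $ 1 = Y $ l $ j"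
      using transposition_matrix[where k = 1 and i = j] by blast
    have "adjugate3 (P1 ** Z ** Q1) = 0"
      using adj0 Z(1) by (simp add: adjugate3_mult)
    moreover have "(P1 ** Z ** Q1) $ 1 $ 1 \<noteq> 0"
      using Z by (simp add: P1 Q1)
    ultimately obtain P Q where PQ: "det P \<noteq> 0" "det Q \<noteq> 0"
      "P ** (P1 ** Z ** Q1) ** Q = vector [vector [1, 0, 0], vector [0, 0, 0], vector [0, 0, 0]]"
      using rank1_normal_form by blast
    let ?h = "\<lambda>Y. (P ** P1) ** Y ** (Q1 ** Q)"
    have "compressible (?h ` V)"
    proof (rule compressible_of_rank1[OF subspace_equivalence[OF V]])
      show "adjugate3 Y = 0" if "Y \<in> ?h ` V" for Y
        using that adj0 by (auto simp: adjugate3_mult)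
      show "vector [vector [1, 0, 0], vector [0, 0, 0], vector [0, 0, 0]] \<in> ?h ` V"
        using Z(1) PQ(3) by (intro image_eqI[of _ _ Z]) (simp_all add: matrix_mul_assoc)
    qed
    then show ?thesis
      using P1 Q1 PQ by (intro compressible_equivalence[where P = "P ** P1" and Q = "Q1 ** Q" and V = V]) (auto simp: det_mul)
  qed
next
  case False
  \<comment> \<open>Entry \<open>(j, i)\<close> of the adjugate belongs to the minor without row
    \<open>i\<close> and column \<open>j\<close>; hence row \<open>i\<close> and column
    \<open>j\<close> are moved to place 3.\<close>
  then obtain Z i j where Z: "Z \<in> V" "adjugate3 Z $ j $ i \<noteq> 0"
    by (auto simp: vec_eq_iff)
  obtain P1 where P1: "det P1 \<noteq> 0" "\<And>(Y :: complex^3^3) l. (Y ** P1) $ l $ 3 = Y $ l $ i" "P1 ** P1 = mat 1"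
    using transposition_matrix[where k = 3 and i = i] by blast
  obtain Q1 where Q1: "det Q1 \<noteq> 0" "\<And>(Y :: complex^3^3) l. (Q1 ** Y) $ 3 $ l = Y $ j $ l" "Q1 ** Q1 = mat 1"
    using transposition_matrix[where k = 3 and i = j] by blast
  have "adjugate3 (mat 1) = mat 1"
    by (simp add: vec_eq_iff forall_3 adjugate3_def mat_def)
  \<comment> \<open>An involution is a scalar multiple of its adjugate, so \<open>Q1\<close> and
    \<open>P1\<close> around \<open>adj(Z)\<close> may be replaced by their adjugates up to a
    factor.\<close>
  then have inv: "R $ a $ b = det R * adjugate3 R $ a $ b" if "R ** R = mat 1" for R a b
  proof -
    have "R = (\<chi> i j. det R * adjugate3 R $ i $ j)"
      using adjugate3_left[of R R] that \<open>adjugate3 (mat 1) = mat 1\<close> by simp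
    from arg_cong[OF this, of "\<lambda>M. M $ a $ b"] show ?thesis
      by simp
  qed
  have "(Q1 ** adjugate3 Z ** P1) $ 3 $ 3
      = (det Q1 * det P1) * (adjugate3 Q1 ** adjugate3 Z ** adjugate3 P1) $ 3 $ 3"
    unfolding matrix_matrix_mult_def
    by (simp add: inv[OF P1(3)] inv[OF Q1(3)] sum_distrib_left sum_distrib_right mult_ac)
  also have "adjugate3 Q1 ** adjugate3 Z ** adjugate3 P1 = adjugate3 (P1 ** Z ** Q1)"
    by (simp add: adjugate3_mult matrix_mul_assoc)
  finally have "adjugate3 (P1 ** Z ** Q1) $ 3 $ 3 \<noteq> 0"
    using Z(2) by (auto simp: P1 Q1)
  moreover have "det (P1 ** Z ** Q1) = 0"
    using det0[OF Z(1)] by (simp add: det_mul)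
  ultimately obtain P Q where PQ: "det P \<noteq> 0" "det Q \<noteq> 0"
    "P ** (P1 ** Z ** Q1) ** Q = vector [vector [1, 0, 0], vector [0, 1, 0], vector [0, 0, 0]]"
    using rank2_normal_form by blast
  let ?h = "\<lambda>Y. (P ** P1) ** Y ** (Q1 ** Q)"
  have "compressible (?h ` V)"
  proof (rule compressible_of_rank2[OF subspace_equivalence[OF V]])
    show "det Y = 0" if "Y \<in> ?h ` V" for Y
      using that det0 by (auto simp: det_mul)
    show "deg6_form A B C D = 0" if "A \<in> ?h ` V" "B \<in> ?h ` V" "C \<in> ?h ` V" "D \<in> ?h ` V" for A B C D
      using that form0 by (auto simp: deg6_form_equivalence)
    show "vector [vector [1, 0, 0], vector [0, 1, 0], vector [0, 0, 0]] \<in> ?h ` V"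
      using Z(1) PQ(3) by (intro image_eqI[of _ _ Z]) (simp_all add: matrix_mul_assoc)
  qed
  then show ?thesis
    using P1 Q1 PQ by (intro compressible_equivalence[where P = "P ** P1" and Q = "Q1 ** Q" and V = V]) (auto simp: det_mul)
qed

subsection \<open>The null cone\<close>

text \<open>A right factor \<open>Q\<close> in place of \<open>matrix_inv B\<close> makes the action
  polynomial in \<open>P\<close> and \<open>Q\<close> and allows arbitrary matrices.\<close>

definition two_sided_mult :: "complex^'n^'n \<Rightarrow> complex^'n^'n \<Rightarrow> complex^'n^'n^'m \<Rightarrow> complex^'n^'n^'m" where
  "two_sided_mult P Q X = (\<chi> k. P ** X $ k ** Q)"

lemma two_sided_mult_comp:
  "two_sided_mult P Q (two_sided_mult P' Q' X) = two_sided_mult (P ** P') (Q' ** Q) X"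
  by (simp add: two_sided_mult_def matrix_mul_assoc)

lemma matrix_inv_unique:
  fixes A :: "complex^'n^'n"
  assumes "A ** B = mat 1" "B ** A = mat 1"
  shows "matrix_inv A = B"
proof -
  have "A ** matrix_inv A = mat 1 \<and> matrix_inv A ** A = mat 1"
    unfolding matrix_inv_def by (rule someI[of _ B]) (use assms in auto)
  then show ?thesis
    by (metis assms(2) matrix_mul_assoc matrix_mul_lid matrix_mul_rid)
qed

lemma matrix_semi_invariants_iff:
  fixes f :: "('n::finite, 'm::finite) mat_poly"
  shows "f \<in> matrix_semi_invariants \<longleftrightarrow> (\<forall>P Q X. det P = 1 \<longrightarrow> det Q = 1 \<longrightarrow>
    mat_poly_eval f (two_sided_mult P Q X) = mat_poly_eval f X)"
proof -
  have inv: "\<exists>C. B ** C = mat 1 \<and> C ** B = mat 1 \<and> det C = 1" if B: "det B = 1" for B :: "complex^'n^'n"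
  proof -
    obtain C where C: "B ** C = mat 1" "C ** B = mat 1"
      using B invertible_det_nz[of B] unfolding invertible_def by auto
    moreover have "det C = 1"
      using C(1) B by (metis det_I det_mul mult_1)
    ultimately show ?thesis by blast
  qed
  have eq: "left_right_action P B X = two_sided_mult P C X" if "B ** C = mat 1" "C ** B = mat 1"
    for P B C and X :: "complex^'n^'n^'m"
    using that by (simp add: two_sided_mult_def left_right_action_def matrix_inv_unique)
  show ?thesis
    unfolding matrix_semi_invariants_def SL_def mem_Collect_eq Ball_def
    by (metis inv eq)
qed

lemma semi_invariant_two_sided_mult:
  assumes "f \<in> matrix_semi_invariants" "det P = 1" "det Q = 1"
  shows "mat_poly_eval f (two_sided_mult P Q X) = mat_poly_eval f X"
  using assms by (simp add: matrix_semi_invariants_iff)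

lemma mat_mult: "mat c ** A = (\<chi> i j. c * A $ i $ j)" for A :: "complex^'n^'n"
  by (simp add: vec_eq_iff matrix_matrix_mult_def mat_def if_distrib[of "\<lambda>x. x * _"] cong: if_cong)

lemma mult_mat: "A ** mat c = (\<chi> i j. c * A $ i $ j)" for A :: "complex^'n^'n"
  by (simp add: vec_eq_iff matrix_matrix_mult_def mat_def if_distrib[of "\<lambda>x. _ * x"] mult.commute cong: if_cong)

lemma det_mat: "det (mat c :: complex^'n^'n) = c ^ CARD('n)"
  by (subst det_diagonal) (auto simp: mat_def)

lemma two_sided_mult_mat:
  "two_sided_mult (mat c) (mat d) X = (\<chi> k i j. (c * d) * X $ k $ i $ j)"
  by (simp add: two_sided_mult_def mat_mult mult_mat vec_eq_iff mult_ac)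

lemma ex_SL_scaling:
  fixes P :: "complex^'n^'n"
  assumes "det P \<noteq> 0"
  shows "\<exists>p P'. p \<noteq> 0 \<and> det P' = 1 \<and> P = mat p ** P' \<and> P = P' ** mat p"
proof -
  \<comment> \<open>A root of the determinant of order \<open>CARD('n)\<close>.\<close>
  define p where "p = exp (Ln (det P) / of_nat CARD('n))"
  have p: "p ^ CARD('n) = det P"
    using assms by (simp add: p_def flip: exp_of_nat_mult)
  moreover have "p \<noteq> 0" by (simp add: p_def)
  ultimately have "det (mat (1 / p) ** P) = 1"
    using assms by (simp add: det_mul det_mat power_one_over)
  then show ?thesis
    using \<open>p \<noteq> 0\<close> by (intro exI[of _ p] exI[of _ "mat (1 / p) ** P"]) (simp add: mat_mult mult_mat)
qed

text \<open>Splitting off scalars \<open>p\<close> and \<open>q\<close> leaves determinant 1 on both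
  sides; by homogeneity the scalars contribute the nonzero factor
  \<open>(p * q) ^ d\<close>.\<close>

lemma semi_invariant_two_sided_mult_GL:
  fixes f :: "('n::finite, 'm::finite) mat_poly"
  assumes f: "f \<in> matrix_semi_invariants" "homogeneous_of_degree d f"
    and "det P \<noteq> 0" "det Q \<noteq> 0"
  shows "mat_poly_eval f (two_sided_mult P Q X) = 0 \<longleftrightarrow> mat_poly_eval f X = 0"
proof -
  obtain p P' where P: "p \<noteq> 0" "det P' = 1" "P = mat p ** P'"
    using ex_SL_scaling[OF assms(3)] by blast
  obtain q Q' where Q: "q \<noteq> 0" "det Q' = 1" "Q = Q' ** mat q"
    using ex_SL_scaling[OF assms(4)] by blast
  have "mat_poly_eval f (two_sided_mult P Q X)
      = mat_poly_eval f (two_sided_mult (mat p) (mat q) (two_sided_mult P' Q' X))"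
    by (simp add: P Q two_sided_mult_comp)
  also have "\<dots> = (p * q) ^ d * mat_poly_eval f X"
    using f P Q by (simp add: two_sided_mult_mat mat_poly_eval_scale semi_invariant_two_sided_mult)
  finally show ?thesis
    using P Q by simp
qed

lemma two_sided_mult_in_null_cone_iff:
  fixes X :: "complex^'n^'n^'m"
  assumes "det P \<noteq> 0" "det Q \<noteq> 0"
  shows "two_sided_mult P Q X \<in> null_cone matrix_semi_invariants \<longleftrightarrow> X \<in> null_cone matrix_semi_invariants"
  using semi_invariant_two_sided_mult_GL[OF _ _ assms] unfolding null_cone_def by blast

section \<open>Contraction by one-parameter subgroups\<close>

lemma power_int_sum:
  fixes z :: "'a::field"
  assumes "z \<noteq> 0"
  shows "z powi (\<Sum>i\<in>A. w i) = (\<Prod>i\<in>A. z powi w i)"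
  using assms by (induction A rule: infinite_finite_induct) (auto simp: power_int_add)

text \<open>The easy half of the Hilbert--Mumford criterion: an invariant is constant along the
  torus orbit \<open>G t\<close>, which tends to 0 with \<open>t\<close>, and a form of positive
  degree vanishes at 0.\<close>

lemma in_null_cone_of_weights:
  fixes X :: "complex^'n^'n^'m" and a b :: "'n \<Rightarrow> int"
  assumes a: "sum a UNIV = 0" and b: "sum b UNIV = 0"
    and pos: "\<And>k i j. X $ k $ i $ j \<noteq> 0 \<Longrightarrow> a i + b j > 0"
  shows "X \<in> null_cone matrix_semi_invariants"
  unfolding null_cone_def
proof (intro CollectI ballI allI impI)
  fix f :: "('n, 'm) mat_poly" and d :: nat
  assume f: "f \<in> matrix_semi_invariants" and d: "0 < d" "homogeneous_of_degree d f"
  \<comment> \<open>Truncation by \<open>nat\<close> only affects entries where \<open>X\<close> is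
    zero, and it makes the curve polynomial in \<open>t\<close>.\<close>
  define G where "G = (\<lambda>t. \<chi> k i j. complex_of_real t ^ nat (a i + b j) * X $ k $ i $ j)"
  have "mat_poly_eval f (G t) = mat_poly_eval f X" if t: "t \<noteq> 0" for t
  proof -
    define D where "D = (\<lambda>(w :: 'n \<Rightarrow> int). \<chi> i j. if i = j then complex_of_real t powi w i else (0::complex))"
    have det: "det (D w) = 1" if "sum w UNIV = 0" for w
    proof -
      have "det (D w) = (\<Prod>i\<in>UNIV. complex_of_real t powi w i)"
        by (subst det_diagonal) (auto simp: D_def)
      also have "\<dots> = complex_of_real t powi (\<Sum>i\<in>UNIV. w i)"
        using t by (simp add: power_int_sum)
      finally show ?thesis using that by simp
    qed
    have "two_sided_mult (D a) (D b) X = G t"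
    proof -
      have "t powi a i * X $ k $ i $ j * t powi b j = t ^ nat (a i + b j) * X $ k $ i $ j" for k i j
      proof (cases "X $ k $ i $ j = 0")
        case False
        then have "complex_of_real t powi a i * t powi b j = t ^ nat (a i + b j)"
          using pos[of k i j] t power_int_add[of "complex_of_real t" "a i" "b j"]
          by (simp add: power_int_def[of _ "a i + b j"])
        then show ?thesis by (simp add: mult_ac)
      qed simp
      then show ?thesis
        by (simp add: vec_eq_iff two_sided_mult_def G_def D_def matrix_matrix_mult_def
            if_distrib[of "\<lambda>x. x * _"] if_distrib[of "\<lambda>x. _ * x"] cong: if_cong)
    qed
    then show ?thesis
      using semi_invariant_two_sided_mult[OF f det[OF a] det[OF b]] by metis
  qed
  then have "\<forall>\<^sub>F t in at 0. mat_poly_eval f (G t) = mat_poly_eval f X"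
    by (auto simp: eventually_at_filter)
  moreover have "(G \<longlongrightarrow> 0) (at 0)"
  proof (intro vec_tendstoI)
    fix k i j
    show "((\<lambda>t. G t $ k $ i $ j) \<longlongrightarrow> 0 $ k $ i $ j) (at 0)"
    proof (cases "X $ k $ i $ j = 0")
      case False
      have "((\<lambda>t. complex_of_real t ^ nat (a i + b j) * X $ k $ i $ j)
          \<longlongrightarrow> complex_of_real 0 ^ nat (a i + b j) * X $ k $ i $ j) (at 0)"
        by (intro tendsto_intros)
      then show ?thesis
        using pos[OF False] by (simp add: G_def power_0_left)
    qed (simp add: G_def)
  qed
  then have "((\<lambda>t. mat_poly_eval f (G t)) \<longlongrightarrow> mat_poly_eval f 0) (at 0)"
    by (rule mat_poly_eval_tendsto)
  ultimately have "mat_poly_eval f X = mat_poly_eval f 0"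
    using tendsto_unique[OF _ tendsto_eventually] by (metis at_neq_bot)
  also have "\<dots> = 0"
    using mat_poly_eval_scale[OF d(2), of 0 0] d(1) by (simp add: zero_vec_def power_0_left)
  finally show "mat_poly_eval f X = 0" .
qed

lemma in_null_cone_of_compressible:
  fixes X :: "complex^'n^'n^'m"
  assumes "compressible V" "\<And>k. X $ k \<in> V"
  shows "X \<in> null_cone matrix_semi_invariants"
proof -
  obtain P Q a b where *: "det P \<noteq> 0" "det Q \<noteq> 0" "sum a UNIV = 0" "sum b UNIV = (0::int)"
    "\<And>Y i j. Y \<in> V \<Longrightarrow> (P ** Y ** Q) $ i $ j \<noteq> 0 \<Longrightarrow> a i + b j > 0"
    using assms(1) unfolding compressible_def by blast
  have "two_sided_mult P Q X \<in> null_cone matrix_semi_invariants"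
    using * assms(2) by (intro in_null_cone_of_weights[of a b]) (auto simp: two_sided_mult_def)
  then show ?thesis
    using * by (simp add: two_sided_mult_in_null_cone_iff)
qed

section \<open>Invariants of linear combinations of the tuple\<close>

definition linear_pencil :: "('m \<Rightarrow> complex) \<Rightarrow> complex^'n^'n^'m \<Rightarrow> complex^'n^'n" where
  "linear_pencil t X = (\<chi> i j. \<Sum>k\<in>UNIV. t k * X $ k $ i $ j)"

lemma linear_pencil_two_sided_mult:
  "linear_pencil t (two_sided_mult P Q X) = P ** linear_pencil t X ** Q"
proof -
  have "linear_pencil t (two_sided_mult P Q X) $ i $ j = (P ** linear_pencil t X ** Q) $ i $ j" for i j
  proof -
    have "linear_pencil t (two_sided_mult P Q X) $ i $ j
        = (\<Sum>k\<in>UNIV. \<Sum>l\<in>UNIV. \<Sum>r\<in>UNIV. P $ i $ r * (t k * X $ k $ r $ l) * Q $ l $ j)"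
      by (simp add: linear_pencil_def two_sided_mult_def matrix_matrix_mult_def sum_distrib_left
          sum_distrib_right mult_ac)
    also have "\<dots> = (\<Sum>l\<in>UNIV. \<Sum>r\<in>UNIV. \<Sum>k\<in>UNIV. P $ i $ r * (t k * X $ k $ r $ l) * Q $ l $ j)"
      by (subst sum.swap, intro sum.cong refl, subst sum.swap, rule refl)
    also have "\<dots> = (P ** linear_pencil t X ** Q) $ i $ j"
      by (simp add: linear_pencil_def matrix_matrix_mult_def sum_distrib_left sum_distrib_right)
    finally show ?thesis .
  qed
  then show ?thesis by (simp add: vec_eq_iff)
qed

text \<open>The range is the complex span of the tuple; \<open>subspace\<close> refers to real
  scalars, as in the lemmas on singular spaces.\<close>

lemma subspace_range_linear_pencil: "subspace (range (\<lambda>t. linear_pencil t X))"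
proof (rule subspaceI)
  have "linear_pencil (\<lambda>k. 0) X = 0"
    by (simp add: linear_pencil_def vec_eq_iff)
  then show "0 \<in> range (\<lambda>t. linear_pencil t X)"
    by (metis rangeI)
next
  fix A B assume "A \<in> range (\<lambda>t. linear_pencil t X)" "B \<in> range (\<lambda>t. linear_pencil t X)"
  then obtain s t where "A = linear_pencil s X" "B = linear_pencil t X" by blast
  then have "A + B = linear_pencil (\<lambda>k. s k + t k) X"
    by (simp add: linear_pencil_def vec_eq_iff distrib_right sum.distrib)
  then show "A + B \<in> range (\<lambda>t. linear_pencil t X)" by blast
next
  fix c :: real and A assume "A \<in> range (\<lambda>t. linear_pencil t X)"
  then obtain t where "A = linear_pencil t X" by blast
  then have "c *\<^sub>R A = linear_pencil (\<lambda>k. c *\<^sub>R t k) X"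
    by (simp add: linear_pencil_def vec_eq_iff scaleR_sum_right)
  then show "c *\<^sub>R A \<in> range (\<lambda>t. linear_pencil t X)" by blast
qed

lemma linear_pencil_unit: "linear_pencil (\<lambda>l. if l = k then 1 else 0) X = X $ k"
  by (simp add: linear_pencil_def vec_eq_iff if_distrib[of "\<lambda>x. x * _"] cong: if_cong)

lemma hom_poly_fun_linear_pencil: "hom_poly_fun 1 (\<lambda>X. linear_pencil t X $ i $ j)"
  unfolding linear_pencil_def
  by (simp del: One_nat_def) (intro hom_poly_fun_sum hom_poly_fun_cmult hom_poly_fun_coord)

lemma hom_poly_fun_matrix_mult:
  assumes "\<And>i j. hom_poly_fun d (\<lambda>X. A X $ i $ j)" "\<And>i j. hom_poly_fun e (\<lambda>X. B X $ i $ j)"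
  shows "hom_poly_fun (d + e) (\<lambda>X. (A X ** B X) $ i $ j)"
  unfolding matrix_matrix_mult_def
  by simp (intro hom_poly_fun_sum hom_poly_fun_mult assms)

lemma hom_poly_fun_adjugate3:
  assumes "\<And>i j. hom_poly_fun d (\<lambda>X. A X $ i $ j)"
  shows "hom_poly_fun (d + d) (\<lambda>X. adjugate3 (A X) $ i $ j)"
proof -
  have "\<forall>i j. hom_poly_fun (d + d) (\<lambda>X. adjugate3 (A X) $ i $ j)"
    unfolding adjugate3_def forall_3 vector_3
    by (intro conjI hom_poly_fun_diff hom_poly_fun_mult assms)
  then show ?thesis by blast
qed

lemma hom_poly_fun_semi_invariant:
  assumes "hom_poly_fun d F"
    and inv: "\<And>P Q X. det P = 1 \<Longrightarrow> det Q = 1 \<Longrightarrow> F (two_sided_mult P Q X) = F X"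
  shows "\<exists>f\<in>matrix_semi_invariants. homogeneous_of_degree d f \<and> mat_poly_eval f = F"
proof -
  obtain f where f: "homogeneous_of_degree d f" "mat_poly_eval f = F"
    using assms(1) unfolding hom_poly_fun_def by blast
  then have "f \<in> matrix_semi_invariants"
    using inv by (simp add: matrix_semi_invariants_iff)
  with f show ?thesis by blast
qed

text \<open>Each fixed choice of coefficients \<open>t\<close> gives one cubic invariant; together
  they detect whether the whole span is singular.\<close>

lemma ex_semi_invariant_det:
  "\<exists>f\<in>matrix_semi_invariants. homogeneous_of_degree 3 f \<and>
     mat_poly_eval f = (\<lambda>X :: complex^3^3^'m. det (linear_pencil t X))"
proof (rule hom_poly_fun_semi_invariant)
  have "hom_poly_fun (1 + 1 + 1) (\<lambda>X :: complex^3^3^'m. det (linear_pencil t X))"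
    unfolding det_3
    by (intro hom_poly_fun_add hom_poly_fun_diff hom_poly_fun_mult hom_poly_fun_linear_pencil)
  then show "hom_poly_fun 3 (\<lambda>X :: complex^3^3^'m. det (linear_pencil t X))"
    by (simp add: numeral_3_eq_3)
qed (simp add: linear_pencil_two_sided_mult det_mul)

lemma ex_semi_invariant_deg6_form:
  "\<exists>f\<in>matrix_semi_invariants. homogeneous_of_degree 6 f \<and>
     mat_poly_eval f = (\<lambda>X :: complex^3^3^'m. deg6_form (linear_pencil r X) (linear_pencil s X)
       (linear_pencil t X) (linear_pencil u X))"
proof (rule hom_poly_fun_semi_invariant)
  have "hom_poly_fun (1 + (1 + 1) + 1 + (1 + 1)) (\<lambda>X :: complex^3^3^'m. deg6_form (linear_pencil r X)
      (linear_pencil s X) (linear_pencil t X) (linear_pencil u X))"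
    unfolding deg6_form_def trace_def
    by (intro hom_poly_fun_sum hom_poly_fun_matrix_mult hom_poly_fun_adjugate3 hom_poly_fun_linear_pencil)
  then show "hom_poly_fun 6 (\<lambda>X :: complex^3^3^'m. deg6_form (linear_pencil r X) (linear_pencil s X)
      (linear_pencil t X) (linear_pencil u X))"
    by (simp add: numeral_eq_Suc)
qed (simp add: linear_pencil_two_sided_mult deg6_form_equivalence)

lemma zero_set_upto_6_subset_null_cone:
  "zero_set_upto 6 matrix_semi_invariants
     \<subseteq> (null_cone matrix_semi_invariants :: (complex^3^3^'m) set)"
proof
  fix X :: "complex^3^3^'m"
  assume "X \<in> zero_set_upto 6 matrix_semi_invariants"
  then have X: "mat_poly_eval f X = 0"
    if "f \<in> matrix_semi_invariants" "homogeneous_of_degree d f" "0 < d" "d \<le> 6" for f d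
    using that unfolding zero_set_upto_def by blast
  have "det (linear_pencil t X) = 0" for t
    using ex_semi_invariant_det[of t] X[where d = 3] by fastforce
  moreover have "deg6_form (linear_pencil r X) (linear_pencil s X)
       (linear_pencil t X) (linear_pencil u X) = 0" for r s t u
    using ex_semi_invariant_deg6_form[of r s t u] X[where d = 6] by fastforce
  ultimately have "compressible (range (\<lambda>t. linear_pencil t X))"
    by (intro compressible_of_singular[OF subspace_range_linear_pencil]) auto
  then show "X \<in> null_cone matrix_semi_invariants"
    by (rule in_null_cone_of_compressible) (metis linear_pencil_unit rangeI)
qed

subsection \<open>Invariants of low degree on skew-symmetric triples\<close>

lemma tendsto_line_at_0:
  "((\<lambda>x. A + x *\<^sub>R B) \<longlongrightarrow> A) (at (0::real))" for A B :: "'a::real_normed_vector"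
proof -
  have "((\<lambda>x. A + x *\<^sub>R B) \<longlongrightarrow> A + 0 *\<^sub>R B) (at (0::real))"
    by (intro tendsto_intros)
  then show ?thesis by simp
qed

lemma primitive_cube_root: "\<exists>w::complex. w ^ 3 = 1 \<and> w \<noteq> 1"
proof -
  let ?w = "Complex (-1/2) (sqrt 3 / 2)"
  have "?w ^ 3 = 1"
    by (simp add: power3_eq_cube complex_eq_iff algebra_simps)
  moreover have "?w \<noteq> 1"
    by (simp add: complex_eq_iff)
  ultimately show ?thesis by blast
qed

section \<open>Tuples supported on three slots with zero diagonals\<close>

locale distinct_slots =
  fixes k1 k2 k3 :: "'m::finite"
  assumes distinct: "k1 \<noteq> k2" "k1 \<noteq> k3" "k2 \<noteq> k3"
begin

definition triple :: "complex^3^3 \<Rightarrow> complex^3^3 \<Rightarrow> complex^3^3 \<Rightarrow> complex^3^3^'m" where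
  "triple A B C = (\<chi> k. if k = k1 then A else if k = k2 then B else if k = k3 then C else 0)"

text \<open>Each slot carries two transposed positions. The parameters \<open>p\<close>,
  \<open>r\<close>, \<open>t\<close> sit at the positions \<open>(2, 3)\<close>,
  \<open>(3, 1)\<close>, \<open>(1, 2)\<close> of a 3-cycle, and \<open>q\<close>, \<open>s\<close>,
  \<open>u\<close> at those of its inverse.\<close>

definition hollow :: "complex \<Rightarrow> complex \<Rightarrow> complex \<Rightarrow> complex \<Rightarrow> complex \<Rightarrow> complex \<Rightarrow> complex^3^3^'m" where
  "hollow p q r s t u = triple
     (vector [vector [0, 0, 0], vector [0, 0, p], vector [0, q, 0]])
     (vector [vector [0, 0, s], vector [0, 0, 0], vector [r, 0, 0]])
     (vector [vector [0, t, 0], vector [u, 0, 0], vector [0, 0, 0]])"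

lemma triple_slots [simp]: "triple A B C $ k1 = A" "triple A B C $ k2 = B" "triple A B C $ k3 = C"
  using distinct by (auto simp: triple_def)

lemma two_sided_mult_triple:
  "two_sided_mult P Q (triple A B C) = triple (P ** A ** Q) (P ** B ** Q) (P ** C ** Q)"
  by (simp add: two_sided_mult_def triple_def vec_eq_iff matrix_matrix_mult_def)

lemma hollow_add:
  "hollow p q r s t u + hollow p' q' r' s' t' u' = hollow (p + p') (q + q') (r + r') (s + s') (t + t') (u + u')"
  by (simp add: hollow_def triple_def vec_eq_iff forall_3)

lemma hollow_scaleR:
  "c *\<^sub>R hollow p q r s t u = hollow (c *\<^sub>R p) (c *\<^sub>R q) (c *\<^sub>R r) (c *\<^sub>R s) (c *\<^sub>R t) (c *\<^sub>R u)"
  by (simp add: hollow_def triple_def vec_eq_iff forall_3)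

lemma hollow_scale:
  "(\<chi> k i j. c * hollow p q r s t u $ k $ i $ j) = hollow (c * p) (c * q) (c * r) (c * s) (c * t) (c * u)"
  by (simp add: hollow_def triple_def vec_eq_iff forall_3)

lemma semi_invariant_hollow_torus:
  assumes f: "f \<in> matrix_semi_invariants" and "a1 * a2 * a3 = 1" "b1 * b2 * b3 = 1"
  shows "mat_poly_eval f (hollow (a2 * b3 * p) (a3 * b2 * q) (a3 * b1 * r) (a1 * b3 * s) (a1 * b2 * t) (a2 * b1 * u))
    = mat_poly_eval f (hollow p q r s t u)"
proof -
  let ?P = "vector [vector [a1, 0, 0], vector [0, a2, 0], vector [0, 0, a3]] :: complex^3^3"
  let ?Q = "vector [vector [b1, 0, 0], vector [0, b2, 0], vector [0, 0, b3]] :: complex^3^3"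
  have "two_sided_mult ?P ?Q (hollow p q r s t u)
      = hollow (a2 * b3 * p) (a3 * b2 * q) (a3 * b1 * r) (a1 * b3 * s) (a1 * b2 * t) (a2 * b1 * u)"
    unfolding hollow_def two_sided_mult_triple
    by (intro arg_cong3[where f = triple])
       (simp_all add: vec_eq_iff forall_3 matrix_matrix_mult_def sum_3 mult_ac)
  moreover have "det ?P = 1" "det ?Q = 1"
    using assms(2,3) by (simp_all add: det_matrix_rows3)
  ultimately show ?thesis
    using semi_invariant_two_sided_mult[OF f] by metis
qed

text \<open>The matrix of a 3-cycle, used on both sides, exchanges the two triples of matrix units
  slot by slot; the cycle is even, so its determinant is 1.\<close>

lemma semi_invariant_hollow_cycle:
  assumes f: "f \<in> matrix_semi_invariants"
  shows "mat_poly_eval f (hollow 1 0 1 0 1 0) = mat_poly_eval f (hollow 0 1 0 1 0 1)"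
proof -
  let ?P = "vector [vector [0, 0, 1], vector [1, 0, 0], vector [0, 1, 0]] :: complex^3^3"
  have "two_sided_mult ?P ?P (hollow 1 0 1 0 1 0) = hollow 0 1 0 1 0 1"
    unfolding hollow_def two_sided_mult_triple
    by (intro arg_cong3[where f = triple])
       (simp_all add: vec_eq_iff forall_3 matrix_matrix_mult_def sum_3)
  moreover have "det ?P = 1"
    by (simp add: det_matrix_rows3)
  ultimately show ?thesis
    using semi_invariant_two_sided_mult[OF f] by metis
qed

text \<open>As \<open>p\<close> or \<open>q\<close> is zero, some torus element fixes the three
  entries of one cycle and multiplies the two remaining entries by \<open>x\<close>. Letting
  \<open>x\<close> tend to 0 deletes them without changing the value of \<open>f\<close>.\<close>

lemma semi_invariant_hollow_degenerate:
  assumes f: "f \<in> matrix_semi_invariants"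
  shows "mat_poly_eval f (hollow 1 0 1 1 1 1) = mat_poly_eval f (hollow 1 0 1 0 1 0)"
    and "mat_poly_eval f (hollow 0 1 1 1 1 1) = mat_poly_eval f (hollow 0 1 0 1 0 1)"
proof -
  have lim: "mat_poly_eval f (A + B) = mat_poly_eval f A"
    if "\<And>x. x \<noteq> 0 \<Longrightarrow> mat_poly_eval f (A + x *\<^sub>R B) = mat_poly_eval f (A + B)" for A B
  proof -
    have "((\<lambda>x. mat_poly_eval f (A + x *\<^sub>R B)) \<longlongrightarrow> mat_poly_eval f A) (at (0::real))"
      by (intro mat_poly_eval_tendsto tendsto_line_at_0)
    moreover have "\<forall>\<^sub>F x in at (0::real). mat_poly_eval f (A + x *\<^sub>R B) = mat_poly_eval f (A + B)"
      using that by (auto simp: eventually_at_filter)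
    ultimately show ?thesis
      using tendsto_unique[OF _ tendsto_eventually] by (metis at_neq_bot)
  qed
  have "mat_poly_eval f (hollow 1 0 1 0 1 0 + x *\<^sub>R hollow 0 0 0 1 0 1)
      = mat_poly_eval f (hollow 1 0 1 0 1 0 + hollow 0 0 0 1 0 1)" if "x \<noteq> 0" for x
    using semi_invariant_hollow_torus[OF f, of "of_real x" 1 "1 / of_real x" "of_real x" "1 / of_real x" 1 1 0 1 1 1 1] that
    unfolding hollow_scaleR hollow_add by (simp add: scaleR_conv_of_real)
  from lim[OF this] show "mat_poly_eval f (hollow 1 0 1 1 1 1) = mat_poly_eval f (hollow 1 0 1 0 1 0)"
    by (simp add: hollow_add)
  have "mat_poly_eval f (hollow 0 1 0 1 0 1 + x *\<^sub>R hollow 0 0 1 0 1 0)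
      = mat_poly_eval f (hollow 0 1 0 1 0 1 + hollow 0 0 1 0 1 0)" if "x \<noteq> 0" for x
    using semi_invariant_hollow_torus[OF f, of "of_real x" "1 / of_real x" 1 "of_real x" 1 "1 / of_real x" 0 1 1 1 1 1] that
    unfolding hollow_scaleR hollow_add by (simp add: scaleR_conv_of_real)
  from lim[OF this] show "mat_poly_eval f (hollow 0 1 1 1 1 1) = mat_poly_eval f (hollow 0 1 0 1 0 1)"
    by (simp add: hollow_add)
qed

text \<open>The diagonal \<open>(s^2, 1/s, 1/s)\<close> on both sides divides \<open>p\<close> and
  \<open>q\<close> by \<open>s^2\<close> and multiplies the other entries by \<open>s\<close>. So
  multiplying \<open>p\<close> and \<open>q\<close> by \<open>s^3\<close> has the same effect on
  \<open>f\<close> as scaling the whole tuple by \<open>s\<close>, which multiplies \<open>f\<close>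
  by \<open>s^3\<close>. A real cube root covers negative \<open>x\<close> too.\<close>

lemma semi_invariant_cubic_hollow_homogeneous:
  assumes f: "f \<in> matrix_semi_invariants" "homogeneous_of_degree 3 f"
  shows "mat_poly_eval f (hollow (x *\<^sub>R p) (x *\<^sub>R q) 1 1 1 1) = x *\<^sub>R mat_poly_eval f (hollow p q 1 1 1 1)"
proof -
  have nz: "mat_poly_eval f (hollow (x *\<^sub>R p) (x *\<^sub>R q) 1 1 1 1) = x *\<^sub>R mat_poly_eval f (hollow p q 1 1 1 1)"
    if "x \<noteq> 0" for x p q
  proof -
    define s where "s = complex_of_real (root 3 x)"
    have s: "s \<noteq> 0" "s ^ 3 = of_real x"
      using that by (simp_all add: s_def odd_real_root_pow flip: of_real_power)
    have "mat_poly_eval f (hollow (s ^ 3 * p) (s ^ 3 * q) 1 1 1 1)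
        = mat_poly_eval f (hollow (s * p) (s * q) (s * 1) (s * 1) (s * 1) (s * 1))"
      using semi_invariant_hollow_torus[OF f(1), of "s\<^sup>2" "1 / s" "1 / s" "s\<^sup>2" "1 / s" "1 / s" "s ^ 3 * p" "s ^ 3 * q" 1 1 1 1] s(1)
      by (simp add: power2_eq_square power3_eq_cube)
    also have "\<dots> = s ^ 3 * mat_poly_eval f (hollow p q 1 1 1 1)"
      unfolding hollow_scale[symmetric] by (rule mat_poly_eval_scale[OF f(2)])
    finally show ?thesis
      by (simp add: s scaleR_conv_of_real)
  qed
  show ?thesis
    \<comment> \<open>For \<open>x = 0\<close>, doubling \<open>p = q = 0\<close> shows that the
      value equals twice itself.\<close>
    using nz[of x p q] nz[of 2 0 0] by (cases "x = 0") (auto simp: scaleR_conv_of_real)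
qed

text \<open>
  Being homogeneous of degree 1 on the plane below, a cubic invariant agrees there with its
  directional derivative at \<open>hollow 0 0 1 1 1 1\<close>, which is linear.
\<close>

lemma semi_invariant_cubic_hollow_linear:
  assumes f: "f \<in> matrix_semi_invariants" "homogeneous_of_degree 3 f"
  shows "mat_poly_eval f (hollow 1 (-1) 1 1 1 1)
    = mat_poly_eval f (hollow 1 0 1 1 1 1) - mat_poly_eval f (hollow 0 1 1 1 1 1)"
proof -
  obtain D where D: "(mat_poly_eval f has_derivative D) (at (hollow 0 0 1 1 1 1))"
    using mat_poly_eval_differentiable unfolding differentiable_def by blast
  have *: "D (hollow p q 0 0 0 0) = mat_poly_eval f (hollow p q 1 1 1 1)" for p q
  proof -
    let ?g = "\<lambda>x::real. hollow 0 0 1 1 1 1 + x *\<^sub>R hollow p q 0 0 0 0"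
    have "(?g has_derivative (\<lambda>x. x *\<^sub>R hollow p q 0 0 0 0)) (at 0)"
      by (auto intro!: derivative_eq_intros)
    moreover have "(mat_poly_eval f has_derivative D) (at (?g 0))"
      using D by simp
    ultimately have "((\<lambda>x. mat_poly_eval f (?g x)) has_derivative (\<lambda>x. D (x *\<^sub>R hollow p q 0 0 0 0))) (at 0)"
      by (rule has_derivative_compose)
    moreover have "(\<lambda>x. mat_poly_eval f (?g x)) = (\<lambda>x. x *\<^sub>R mat_poly_eval f (hollow p q 1 1 1 1))"
      by (simp add: hollow_scaleR hollow_add semi_invariant_cubic_hollow_homogeneous[OF f])
    moreover have "((\<lambda>x. x *\<^sub>R mat_poly_eval f (hollow p q 1 1 1 1)) has_derivative
        (\<lambda>x. x *\<^sub>R mat_poly_eval f (hollow p q 1 1 1 1))) (at 0)"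
      by (auto intro!: derivative_eq_intros)
    ultimately have "(\<lambda>x. D (x *\<^sub>R hollow p q 0 0 0 0)) = (\<lambda>x. x *\<^sub>R mat_poly_eval f (hollow p q 1 1 1 1))"
      using has_derivative_unique by metis
    from fun_cong[OF this, of 1] show ?thesis by simp
  qed
  have "D (hollow 1 (-1) 0 0 0 0 + hollow 0 1 0 0 0 0) = D (hollow 1 (-1) 0 0 0 0) + D (hollow 0 1 0 0 0 0)"
    using D has_derivative_linear linear_add by blast
  then show ?thesis
    by (simp add: * hollow_add)
qed

lemma semi_invariant_low_degree_hollow:
  assumes f: "f \<in> matrix_semi_invariants" "homogeneous_of_degree d f" and d: "0 < d" "d \<le> 5"
  shows "mat_poly_eval f (hollow 1 (-1) 1 1 1 1) = 0"
proof (cases "d = 3")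
  case True
  \<comment> \<open>Both terms of the difference degenerate to triples of matrix units, which the
    cyclic permutation identifies.\<close>
  then show ?thesis
    using f semi_invariant_cubic_hollow_linear semi_invariant_hollow_degenerate semi_invariant_hollow_cycle
    by simp
next
  case False
  obtain w :: complex where w: "w ^ 3 = 1" "w \<noteq> 1"
    using primitive_cube_root by blast
  then have "w ^ 2 \<noteq> 1"
    by (auto simp: power3_eq_cube power2_eq_square)
  \<comment> \<open>Splitting off 3 reduces \<open>w ^ d\<close> to \<open>w\<close> or
    \<open>w ^ 2\<close>; multiplication by \<open>w\<close> on the left has determinant 1.\<close>
  have "d = 1 \<or> d = 2 \<or> d = 1 + 3 \<or> d = 2 + 3"
    using d False by arith
  then have "w ^ d \<noteq> 1"
    using w \<open>w ^ 2 \<noteq> 1\<close> by (elim disjE) (simp_all only: power_add power_one_right mult_1_right not_False_eq_True)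
  let ?X = "hollow 1 (-1) 1 1 1 1"
  have "mat_poly_eval f ?X = mat_poly_eval f (two_sided_mult (mat w) (mat 1) ?X)"
    using f(1) w(1) by (intro semi_invariant_two_sided_mult[symmetric]) (simp_all add: det_mat)
  also have "\<dots> = w ^ d * mat_poly_eval f ?X"
    by (simp add: two_sided_mult_mat mat_poly_eval_scale[OF f(2)])
  finally show ?thesis
    using \<open>w ^ d \<noteq> 1\<close> by simp
qed

text \<open>
  \<open>hollow 1 (-1) 1 1 1 1\<close> spans, up to a change of bases, the space of skew-symmetric matrices.
\<close>

lemma hollow_not_in_null_cone: "hollow 1 (-1) 1 1 1 1 \<notin> null_cone matrix_semi_invariants"
proof -
  let ?X = "hollow 1 (-1) 1 1 1 1" and ?e = "\<lambda>k l. if l = k then 1 else 0 :: complex"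
  obtain f where f: "f \<in> matrix_semi_invariants" "homogeneous_of_degree 6 f"
    "mat_poly_eval f = (\<lambda>X :: complex^3^3^'m. deg6_form (linear_pencil (?e k1) X)
       (linear_pencil (?e k2) X) (linear_pencil (?e k1) X) (linear_pencil (?e k3) X))"
    using ex_semi_invariant_deg6_form by blast
  \<comment> \<open>The adjugates of the second and third slots are minus the matrix units at
    \<open>(2, 2)\<close> and \<open>(3, 3)\<close>, so the value is the product of the two entries
    1 and -1 of the first slot.\<close>
  have "mat_poly_eval f ?X \<noteq> 0"
    unfolding f(3) linear_pencil_unit
    by (simp add: hollow_def deg6_form_def trace_def matrix_matrix_mult_def adjugate3_def sum_3)
  then show ?thesis
    using f(1,2) unfolding null_cone_def by force
qed

end

theorem corollary1p11:
  assumes "CARD('m::finite) \<ge> 3"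
  shows "null_cone_gamma (matrix_semi_invariants :: (3, 'm) mat_poly set) = 6"
proof -
  let ?R = "matrix_semi_invariants :: (3, 'm) mat_poly set"
  obtain k1 k2 k3 :: 'm where "k1 \<noteq> k2" "k1 \<noteq> k3" "k2 \<noteq> k3"
    using assms by (auto simp: numeral_3_eq_3 card_le_Suc_iff)
  then interpret distinct_slots k1 k2 k3
    by unfold_locales
  show ?thesis
    unfolding null_cone_gamma_def
  proof (rule Least_equality)
    show "null_cone ?R = zero_set_upto 6 ?R"
      using zero_set_upto_6_subset_null_cone by (auto simp: null_cone_def zero_set_upto_def)
    show "6 \<le> D" if "null_cone ?R = zero_set_upto D ?R" for D
    proof (rule ccontr)
      assume "\<not> 6 \<le> D"
      then have "hollow 1 (-1) 1 1 1 1 \<in> zero_set_upto D ?R"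
        by (auto simp: zero_set_upto_def intro: semi_invariant_low_degree_hollow)
      then show False
        using that hollow_not_in_null_cone by simp
    qed
  qed
qed

end
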